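(* Let $\mathbb{k}$ be a field and let $m,n$ be positive integers such that there exist $p,q\in\mathbb{k}^*$ with $\operatorname{ord}(p)=m$, $\operatorname{ord}(q)=n$ and $pq\neq1$. Let $l=\operatorname{lcm}(m,n)$. Then $\operatorname{ord}(pq)=l$ for all $p,q\in\mathbb{k}^*$ with $\operatorname{ord}(p)=m$, $\operatorname{ord}(q)=n$ and $pq\neq1$ if and only if either $m=n$ is an odd prime, or $|e_m(p_i)-e_n(p_i)|\ge1$ for all primes $p_i$ in the prime factorization of $m$ or $n$.
   Context: $\mathbb{k}^*=\mathbb{k}\setminus\{0\}$, and $\operatorname{ord}$ denotes multiplicative order. For a positive integer $k$ and a prime $p_i$, $e_k(p_i)$ denotes the exponent of $p_i$ in the prime factorization of $k$ (so $e_k(p_i)=0$ if $p_i\nmid k$). "All primes in the prime factorization of $m$ or $n$" means all primes dividing $m$ or dividing $n$. *)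

theory Defs
  imports "HOL-Algebra.Multiplicative_Group" "HOL-Computational_Algebra.Primes"
begin

end

theory Submission
  imports Defs "HOL-Algebra.Polynomial_Divisibility" "HOL-Number_Theory.Cong"
begin

hide_const (open) Divisibility.prime Ring_Divisibility.mult_of

text \<open>
  If \<open>ord (p \<otimes> q)\<close> is a proper divisor of \<open>l = lcm m n\<close>, it divides \<open>l div r\<close> for some prime \<open>r\<close>.
  When the exponents of \<open>r\<close> in \<open>m\<close> and \<open>n\<close> differ, exactly one of \<open>p\<close> and \<open>q\<close> is killed by the
  power \<open>l div r\<close>, so this is impossible.
  When they agree and are positive, \<open>p [^] (l div r)\<close> and \<open>q [^] (l div r)\<close> both have order \<open>r\<close>;
  the \<open>r\<close>-th roots of unity in a field form a cyclic group, so \<open>q\<close> can be replaced by a power of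
  the same order such that the two cancel. If \<open>m \<noteq> n\<close> this is the required counterexample. If
  \<open>m = n\<close> is composite with least prime factor \<open>r\<close>, then \<open>p\<close> and \<open>p [^] (r - 1)\<close> have order \<open>m\<close>,
  but their product \<open>p [^] r\<close> has order \<open>m div r\<close>.
\<close>

section \<open>Prime exponents in \<open>lcm m n div r\<close>\<close>

text \<open>The exponent of \<open>r\<close> in the lcm is the one in \<open>m\<close>, so dividing
  by \<open>r\<close> leaves one factor \<open>r\<close> too few.\<close>

lemma not_dvd_lcm_div_prime:
  fixes m n r :: nat
  assumes r: "prime r" "r dvd m" and pos: "m > 0" "n > 0"
    and le: "multiplicity r n \<le> multiplicity r m"
  shows "\<not> m dvd lcm m n div r"
proof
  assume dvd: "m dvd lcm m n div r"
  have rl: "r dvd lcm m n" using r by (meson dvd_lcm1 dvd_trans)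
  then obtain k where k: "lcm m n = r * k" by blast
  have k0: "k \<noteq> 0" using k pos by (metis lcm_eq_0_iff mult_0_right not_gr_zero)
  have "multiplicity r (lcm m n) = Suc (multiplicity r k)"
    using k k0 r by (simp add: multiplicity_times_same prime_nat_iff)
  moreover have "multiplicity r (lcm m n) = multiplicity r m"
    using le pos r by (simp add: multiplicity_lcm)
  moreover have "multiplicity r m \<le> multiplicity r k"
    using dvd k k0 r by (intro dvd_imp_multiplicity_le) (auto simp: prime_gt_0_nat)
  ultimately show False by simp
qed

text \<open>The lcm has at least one factor \<open>r\<close> more than \<open>n\<close>, so even
  \<open>r * n\<close> divides it; this is checked prime by prime.\<close>

lemma dvd_lcm_div_prime:
  fixes m n r :: nat
  assumes r: "prime r" and pos: "m > 0" "n > 0"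
    and less: "multiplicity r n < multiplicity r m"
  shows "n dvd lcm m n div r"
proof -
  have "r * n dvd lcm m n"
  proof (rule multiplicity_le_imp_dvd)
    fix p :: nat assume p: "prime p"
    show "multiplicity p (r * n) \<le> multiplicity p (lcm m n)"
      using r p pos less
      by (cases "p = r")
         (auto simp: prime_elem_multiplicity_mult_distrib multiplicity_lcm
            prime_multiplicity_other prime_gt_0_nat)
  qed (use r pos in \<open>auto simp: prime_gt_0_nat\<close>)
  thus ?thesis by (metis dvd_div_iff_mult dvd_mult_left mult.commute r not_prime_0)
qed

text \<open>Any prime factor of the cofactor \<open>l div d\<close> serves as
  \<open>r\<close>.\<close>

lemma proper_dvd_imp_dvd_div_prime:
  fixes d l :: nat
  assumes "d dvd l" "d \<noteq> l" "l > 0"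
  obtains r where "prime r" "r dvd l" "d dvd l div r"
proof -
  from assms obtain k where k: "l = d * k" by blast
  with assms have "k \<noteq> 1" by auto
  then obtain r where r: "prime r" "r dvd k" using prime_factor_nat by blast
  then obtain j where j: "k = r * j" by blast
  have "l div r = d * j" using k j r by (simp add: prime_gt_0_nat mult.left_commute)
  thus ?thesis using that[of r] r k by auto
qed

section \<open>Order of a product when all exponents differ\<close>

lemma (in comm_group) ord_mult_eq_lcm:
  assumes p: "p \<in> carrier G" and q: "q \<in> carrier G"
    and pos: "ord p > 0" "ord q > 0"
    and neq: "\<And>r. prime r \<Longrightarrow> r dvd lcm (ord p) (ord q) \<Longrightarrow>
                multiplicity r (ord p) \<noteq> multiplicity r (ord q)"
  shows "ord (p \<otimes> q) = lcm (ord p) (ord q)"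
proof (rule ccontr)
  let ?l = "lcm (ord p) (ord q)"
  \<comment> \<open>Stated for arbitrary \<open>p\<close> and \<open>q\<close>, so that it also
    covers the case with their roles exchanged.\<close>
  have key: False
    if p: "p \<in> carrier G" and q: "q \<in> carrier G" and pos: "ord p > 0" "ord q > 0"
      and r: "prime r" and eq: "(p \<otimes> q) [^] (lcm (ord p) (ord q) div r) = \<one>"
      and less: "multiplicity r (ord q) < multiplicity r (ord p)" for p q and r :: nat
  proof -
    let ?k = "lcm (ord p) (ord q) div r"
    have "q [^] ?k = \<one>" using dvd_lcm_div_prime[OF r pos less] q by (simp add: pow_eq_id)
    hence "p [^] ?k = \<one>" using eq p q by (simp add: nat_pow_distrib)
    moreover have "r dvd ord p" using less not_dvd_imp_multiplicity_0 by fastforce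
    ultimately show False
      using not_dvd_lcm_div_prime[OF r _ pos] less p by (simp add: pow_eq_id)
  qed
  assume "ord (p \<otimes> q) \<noteq> ?l"
  moreover have "ord (p \<otimes> q) dvd ?l"
  proof -
    have "p [^] ?l = \<one>" "q [^] ?l = \<one>" using p q by (simp_all add: pow_eq_id)
    hence "(p \<otimes> q) [^] ?l = \<one>" using p q by (simp add: nat_pow_distrib)
    thus ?thesis using p q by (simp add: pow_eq_id)
  qed
  moreover have "?l > 0" using pos by (simp add: lcm_pos_nat)
  ultimately obtain r where r: "prime r" "r dvd ?l" "ord (p \<otimes> q) dvd ?l div r"
    by (metis proper_dvd_imp_dvd_div_prime)
  have eq: "(p \<otimes> q) [^] (?l div r) = \<one>" using r(3) p q by (simp add: pow_eq_id)
  from neq[OF r(1,2)]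
  consider "multiplicity r (ord q) < multiplicity r (ord p)"
    | "multiplicity r (ord p) < multiplicity r (ord q)" by linarith
  thus False
  proof cases
    case 1 thus False using key[OF p q pos r(1) eq] by simp
  next
    case 2 thus False using key[OF q p pos(2,1) r(1)] eq p q
      by (simp add: m_comm lcm.commute)
  qed
qed

section \<open>Roots of unity in a field\<close>

lemma (in field) card_roots_of_unity_le:
  assumes "n > 0"
  shows "finite {x \<in> carrier R. x [^] n = \<one>} \<and> card {x \<in> carrier R. x [^] n = \<one>} \<le> n"
proof -
  \<comment> \<open>Coefficients are listed from the leading one down, so appending the constant
    term to X^(n-1) shifts it by one degree: this list is X^n - 1.\<close>
  let ?p = "monom \<one> (n - 1) @ [\<ominus> \<one>]"
  have set: "set (monom \<one> (n - 1)) \<subseteq> carrier R" by (simp add: monom_in_carrier)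
  have len: "degree ?p = n" using assms by (simp add: monom_def)
  have "hd ?p = \<one>" by (simp add: monom_def)
  hence p: "?p \<in> carrier (poly_ring R)"
    using set by (auto simp: univ_poly_carrier[symmetric] polynomial_def)
  have "eval ?p x = x [^] n \<ominus> \<one>" if "x \<in> carrier R" for x
    using that set assms eval_append_aux[OF set _ that, of "\<ominus> \<one>"]
    by (cases n) (auto simp: eval_monom minus_eq)
  hence "{x \<in> carrier R. x [^] n = \<one>} = set_mset (roots ?p)"
    using roots_mem_iff_is_root[OF p] by (auto simp: is_root_def)
  moreover have "card (set_mset (roots ?p)) \<le> n"
    using size_mset_mono[OF mset_set_set_mset_msubset[of "roots ?p"]] size_roots_le_degree[OF p]
    by (simp only: size_mset_set len)
  ultimately show ?thesis by simp
qed

text \<open>The powers of \<open>v\<close> already provide \<open>ord v\<close> distinct roots of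
  unity of that exponent, and a field has no more of them.\<close>

lemma (in field) root_of_unity_is_power:
  assumes v: "v \<in> carrier (mult_of R)" and pos: "group.ord (mult_of R) v > 0"
    and u: "u \<in> carrier R" and un: "u [^] group.ord (mult_of R) v = \<one>"
  obtains c :: nat where "u = v [^] c"
proof -
  interpret M: group "mult_of R" by (rule field_mult_group)
  let ?n = "M.ord v"
  let ?S = "{x \<in> carrier R. x [^] ?n = \<one>}"
  let ?T = "(\<lambda>i. v [^] i) ` {1..?n}"
  have vR: "v \<in> carrier R" using v by simp
  have "v [^] ?n = \<one>" using M.pow_ord_eq_1[OF v] by (simp add: Multiplicative_Group.nat_pow_mult_of)
  hence "(v [^] i) [^] ?n = \<one>" for i :: nat
    using vR nat_pow_pow[of v i ?n] nat_pow_pow[of v ?n i] by (simp add: mult.commute)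
  hence sub: "?T \<subseteq> ?S" using vR by auto
  have card: "card ?T = ?n"
    using M.ord_inj'[OF v] by (simp add: card_image Multiplicative_Group.nat_pow_mult_of)
  have "?T = ?S"
  proof (rule card_seteq[OF _ sub])
    show "finite ?S" "card ?S \<le> card ?T"
      unfolding card using card_roots_of_unity_le[OF pos] by blast+
  qed
  moreover have "u \<in> ?S" using u un by simp
  ultimately have "u \<in> ?T" by simp
  thus ?thesis using that by auto
qed

section \<open>Replacing \<open>q\<close> by a power of the same order\<close>

text \<open>Write \<open>n\<close> as a power of \<open>r\<close> times a part \<open>s\<close>
  prime to \<open>r\<close>. The Chinese remainder theorem allows \<open>b\<close> to be
  \<open>a\<close> modulo \<open>r\<close> and 1 modulo \<open>s\<close>, hence prime to both
  factors.\<close>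

lemma exists_coprime_cong:
  fixes a r n :: nat
  assumes r: "prime r" "\<not> r dvd a" and n: "n > 0"
  obtains b where "coprime b n" "[b = a] (mod r)"
proof -
  obtain s where s: "n = r ^ multiplicity r n * s" "\<not> r dvd s"
    using multiplicity_decompose'[of n r] n r by (metis not_prime_unit not_gr_zero)
  have "coprime r s" using r s by (simp add: prime_imp_coprime)
  then obtain b where b: "[b = a] (mod r)" "[b = 1] (mod s)"
    using binary_chinese_remainder_nat by blast
  have "coprime a r" using prime_imp_coprime[OF r] by (simp add: coprime_commute)
  hence "coprime b r" using b(1) by (meson cong_imp_coprime cong_sym)
  moreover have "coprime b s" using cong_imp_coprime[OF cong_sym[OF b(2)]] by simp
  ultimately have "coprime b n" by (subst s(1)) auto
  thus ?thesis using that b(1) by blast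
qed

lemma (in group) ord_pow_coprime:
  assumes "x \<in> carrier G" "coprime k (ord x)"
  shows "ord (x [^] k) = ord x"
  using assms by (auto simp: ord_pow_gen coprime_iff_gcd_eq_1 gcd.commute)

text \<open>Coprimality of \<open>b\<close> and \<open>n\<close> is required so that
  \<open>q [^] b\<close> still has order \<open>n\<close> and can be put in place of
  \<open>q\<close>.\<close>

lemma (in field) exists_coprime_pow_ord_dvd:
  assumes p: "p \<in> carrier (mult_of R)" and q: "q \<in> carrier (mult_of R)"
    and m: "group.ord (mult_of R) p = m" "m > 0" and n: "group.ord (mult_of R) q = n" "n > 0"
    and r: "prime r" "r dvd m" and eq: "multiplicity r m = multiplicity r n"
  obtains b where "coprime b n" "group.ord (mult_of R) (p \<otimes> q [^] b) dvd lcm m n div r"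
proof -
  interpret M: comm_group "mult_of R"
    using units_comm_group mult_of_is_Units by simp
  note [simp] = Multiplicative_Group.nat_pow_mult_of
  have "multiplicity r m > 0" using r m by (simp add: prime_multiplicity_gt_zero_iff)
  hence rn: "r dvd n" using eq not_dvd_imp_multiplicity_0[of r n] by fastforce
  let ?k = "lcm m n div r"
  have kr: "?k * r = lcm m n" using r by (metis dvd_div_mult_self dvd_lcm1 dvd_trans)
  define u v where "u = p [^] ?k" and "v = q [^] ?k"
  have u: "u \<in> carrier (mult_of R)" and v: "v \<in> carrier (mult_of R)"
    using M.nat_pow_closed[OF p, of ?k] M.nat_pow_closed[OF q, of ?k] by (auto simp: u_def v_def)
  have one: "u [^] r = \<one>" "v [^] r = \<one>"
    using p q m n kr M.pow_eq_id[OF p, of "lcm m n"] M.pow_eq_id[OF q, of "lcm m n"]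
    by (simp_all add: u_def v_def nat_pow_pow)
  have "u \<noteq> \<one>"
    using not_dvd_lcm_div_prime[of r m n] M.pow_eq_id[OF p, of ?k] r m n eq by (simp add: u_def)
  have "v \<noteq> \<one>"
    using not_dvd_lcm_div_prime[of r n m] M.pow_eq_id[OF q, of ?k] r rn m n eq
    by (simp add: v_def lcm.commute)
  have "M.ord v dvd r" using M.pow_eq_id[OF v, of r] one by simp
  moreover have "M.ord v \<noteq> 1" using M.ord_eq_1[OF v] \<open>v \<noteq> \<one>\<close> by simp
  ultimately have ov: "M.ord v = r" using r prime_nat_iff by blast
  obtain c :: nat where c: "u = v [^] c"
    using root_of_unity_is_power[OF v, of u] ov one u r by (auto simp: prime_gt_0_nat)
  have "\<not> r dvd c" using c \<open>u \<noteq> \<one>\<close> M.pow_eq_id[OF v, of c] ov by simp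
  \<comment> \<open>Over the natural numbers \<open>(r - 1) * c\<close> stands for -c modulo
    \<open>r\<close>. It is prime to \<open>r\<close>, so it can be lifted to an exponent coprime to
    \<open>n\<close>.\<close>
  hence "\<not> r dvd (r - 1) * c"
    using r prime_gt_1_nat[of r] by (auto simp: prime_dvd_mult_iff dest: dvd_imp_le)
  then obtain b where b: "coprime b n" "[b = (r - 1) * c] (mod r)"
    using exists_coprime_cong r n by metis
  have "[c + b = c + (r - 1) * c] (mod r)" using b(2) by (simp add: cong_add_lcancel_nat)
  also have "c + (r - 1) * c = r * c"
    using r prime_gt_0_nat[of r] by (cases r) auto
  finally have "r dvd c + b" by (simp add: cong_dvd_iff)
  hence "v [^] (c + b) = \<one>" using M.pow_eq_id[OF v, of "c + b"] ov by simp
  moreover have "(p \<otimes> q [^] b) [^] ?k = u \<otimes> v [^] b"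
    using p q by (simp add: u_def v_def nat_pow_distrib nat_pow_pow mult.commute)
  ultimately have "(p \<otimes> q [^] b) [^] ?k = \<one>" using v c by (simp add: nat_pow_mult)
  moreover have "p \<otimes> q [^] b \<in> carrier (mult_of R)"
    using M.m_closed[OF p M.nat_pow_closed[OF q, of b]] by simp
  ultimately have "M.ord (p \<otimes> q [^] b) dvd ?k" using M.pow_eq_id by fastforce
  thus ?thesis using that b by blast
qed

text \<open>Take the least prime factor \<open>r\<close> of \<open>m\<close>: a prime dividing
  \<open>r - 1\<close> is smaller than \<open>r\<close> and so cannot divide
  \<open>m\<close>.\<close>

lemma least_prime_factor:
  fixes m :: nat
  assumes "m \<noteq> 1" "m > 0"
  obtains r where "prime r" "r dvd m" "coprime (r - 1) m"
proof -
  define r where "r = (LEAST r. prime r \<and> r dvd m)"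
  have r: "prime r" "r dvd m"
    using LeastI_ex[of "\<lambda>r. prime r \<and> r dvd m"] prime_factor_nat assms unfolding r_def by blast+
  have "coprime (r - 1) m"
  proof (rule ccontr)
    assume "\<not> coprime (r - 1) m"
    then obtain t where t: "prime t" "t dvd r - 1" "t dvd m"
      by (metis coprime_iff_gcd_eq_1 gcd_nat.bounded_iff prime_factor_nat)
    have "t \<le> r - 1" using t r prime_gt_1_nat by (intro dvd_imp_le) auto
    moreover have "r \<le> t" unfolding r_def using t by (intro Least_le) auto
    ultimately show False using r prime_gt_1_nat[of r] by linarith
  qed
  thus ?thesis using that r by blast
qed

theorem proposition8p2:
  fixes K (structure) and m n :: nat
  assumes "field K"
    and "m > 0" and "n > 0"
    and "\<exists>p \<in> carrier (mult_of K). \<exists>q \<in> carrier (mult_of K).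
           group.ord (mult_of K) p = m \<and> group.ord (mult_of K) q = n \<and> p \<otimes> q \<noteq> \<one>"
  shows "(\<forall>p \<in> carrier (mult_of K). \<forall>q \<in> carrier (mult_of K).
            group.ord (mult_of K) p = m \<and> group.ord (mult_of K) q = n \<and> p \<otimes> q \<noteq> \<one>
              \<longrightarrow> group.ord (mult_of K) (p \<otimes> q) = lcm m n)
         \<longleftrightarrow>
         (m = n \<and> prime m \<and> odd m) \<or>
         (\<forall>r \<in> prime_factors m \<union> prime_factors n.
            \<bar>int (multiplicity r m) - int (multiplicity r n)\<bar> \<ge> 1)"
    (is "?ord_lcm \<longleftrightarrow> ?odd_prime \<or> ?differ")
proof -
  interpret field K by fact
  interpret M: comm_group "mult_of K"
    using units_comm_group mult_of_is_Units by simp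
  note [simp] = Multiplicative_Group.nat_pow_mult_of
  show ?thesis
  proof

    \<comment> \<open>Necessity of the arithmetic condition\<close>
    assume ?ord_lcm
    hence lcm: "M.ord (p \<otimes> q) = lcm m n"
      if "p \<in> carrier (mult_of K)" "q \<in> carrier (mult_of K)" "M.ord p = m" "M.ord q = n"
        "p \<otimes> q \<noteq> \<one>" for p q
      using that by blast
    obtain p q where p: "p \<in> carrier (mult_of K)" "M.ord p = m"
      and q: "q \<in> carrier (mult_of K)" "M.ord q = n" and pq: "p \<otimes> q \<noteq> \<one>"
      using assms(4) by blast
    show "?odd_prime \<or> ?differ"
    proof (cases "m = n")
      case True
      \<comment> \<open>For \<open>m = n = 1\<close> both elements would be trivial, against
        \<open>p \<otimes> q \<noteq> \<one>\<close>.\<close>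
      have m1: "m \<noteq> 1"
        using M.ord_eq_1[OF p(1)] M.ord_eq_1[OF q(1)] p q pq True by auto
      then obtain r where r: "prime r" "r dvd m" "coprime (r - 1) m"
        using least_prime_factor assms(2) by blast
      have prod: "p \<otimes> p [^] (r - 1) = p [^] r"
        using p r nat_pow_Suc2[of p "r - 1"] by (simp add: prime_gt_0_nat)
      have ordr: "M.ord (p [^] r) = m div r"
        using M.ord_pow[of p r] p r by (auto simp: prime_gt_0_nat)
      have "m div r < m" using prime_gt_1_nat[OF r(1)] assms(2) by simp
      have "m = r"
      proof (rule ccontr)
        \<comment> \<open>Then \<open>p [^] r\<close> is nontrivial, so the assumption on products
          applies to \<open>p\<close> and \<open>p [^] (r - 1)\<close>.\<close>
        assume "m \<noteq> r"
        hence "m div r \<noteq> 1" using r by auto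
        hence "p [^] r \<noteq> \<one>" using ordr M.ord_id by auto
        moreover have "M.ord (p [^] (r - 1)) = n"
          using M.ord_pow_coprime[of p "r - 1"] p r True by simp
        ultimately have "M.ord (p [^] r) = m"
          using lcm[of p "p [^] (r - 1)"] p M.nat_pow_closed[of p "r - 1"] prod True by simp
        with ordr \<open>m div r < m\<close> show False by simp
      qed
      \<comment> \<open>For order 2, \<open>q\<close> would be an odd power of \<open>p\<close>, so
        \<open>p \<otimes> q\<close> would be an even power of \<open>p\<close> and hence
        trivial.\<close>
      moreover have "m \<noteq> 2"
      proof
        assume "m = 2"
        hence ord2: "M.ord p = 2" "M.ord q = 2" using p q True by auto
        have "q [^] (2::nat) = \<one>" using M.pow_eq_id[OF q(1), of 2] ord2 by simp
        then obtain c :: nat where c: "q = p [^] c"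
          using root_of_unity_is_power[OF p(1), of q] q ord2 by auto
        have "q \<noteq> \<one>" using q True m1 M.ord_id by auto
        hence "odd c" using c M.pow_eq_id[OF p(1), of c] ord2 by simp
        hence "p [^] Suc c = \<one>" using M.pow_eq_id[OF p(1), of "Suc c"] ord2 by simp
        thus False using pq c p nat_pow_Suc2[of p c] by simp
      qed
      ultimately show ?thesis using r True primes_dvd_imp_eq[of 2 m] by auto
    next
      case False
      have ?differ
      proof (rule ccontr)
        assume "\<not> ?differ"
        then obtain r where r: "r \<in> prime_factors m \<union> prime_factors n"
          and eq: "multiplicity r m = multiplicity r n" by force
        have rp: "prime r" using r by auto
        have "multiplicity r m > 0"
          using r eq by (auto simp: prime_factors_multiplicity)
        hence "r dvd m" using not_dvd_imp_multiplicity_0 by fastforce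
        then obtain b where b: "coprime b n" "M.ord (p \<otimes> q [^] b) dvd lcm m n div r"
          using exists_coprime_pow_ord_dvd[OF p(1) q(1) p(2) assms(2) q(2) assms(3) rp _ eq] by blast
        let ?q = "q [^] b"
        have q': "?q \<in> carrier (mult_of K)" "M.ord ?q = n"
          using M.nat_pow_closed[OF q(1), of b] M.ord_pow_coprime[OF q(1), of b] q b by auto
        \<comment> \<open>Inverse elements have equal orders, so a trivial product would force
          \<open>m = n\<close>.\<close>
        have "p \<otimes> ?q \<noteq> \<one>"
        proof
          assume "p \<otimes> ?q = \<one>"
          hence "p = inv\<^bsub>mult_of K\<^esub> ?q" using M.inv_equality[of p ?q] p q' by simp
          hence "m = n" using p q' M.ord_inv by metis
          with False show False ..
        qed
        hence "lcm m n dvd lcm m n div r" using lcm[OF p(1) q'(1) p(2) q'(2)] b by simp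
        moreover have "lcm m n div r < lcm m n"
          using prime_gt_1_nat[OF rp] assms by (simp add: lcm_pos_nat)
        \<comment> \<open>Everything divides 0, so positivity is needed to turn the divisibility
          into a contradictory inequality.\<close>
        moreover have "lcm m n div r > 0"
          using dvd_imp_le[OF dvd_trans[OF \<open>r dvd m\<close> dvd_lcm1], of n] assms rp
          by (simp add: div_greater_zero_iff lcm_pos_nat prime_gt_0_nat)
        ultimately show False using dvd_imp_le[of "lcm m n" "lcm m n div r"] by linarith
      qed
      thus ?thesis ..
    qed
  next

    \<comment> \<open>Sufficiency of the arithmetic condition\<close>
    assume R: "?odd_prime \<or> ?differ"
    show ?ord_lcm
    proof (intro ballI impI, elim conjE)
      fix p q assume p: "p \<in> carrier (mult_of K)" "M.ord p = m"
        and q: "q \<in> carrier (mult_of K)" "M.ord q = n" and pq: "p \<otimes> q \<noteq> \<one>"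
      from R show "M.ord (p \<otimes> q) = lcm m n"
      proof
        assume A: ?odd_prime
        have c: "p \<otimes> q \<in> carrier (mult_of K)" using M.m_closed[OF p(1) q(1)] by simp
        have "p [^] m = \<one>" "q [^] m = \<one>"
          using p q A M.pow_ord_eq_1[of p] M.pow_ord_eq_1[of q] by simp_all
        hence "(p \<otimes> q) [^] m = \<one>" using p q by (simp add: nat_pow_distrib)
        hence "M.ord (p \<otimes> q) dvd m" using M.pow_eq_id[OF c, of m] by simp
        \<comment> \<open>A divisor of the prime \<open>m\<close> other than 1 is \<open>m\<close>
          itself, which is the lcm because \<open>m = n\<close>.\<close>
        moreover have "M.ord (p \<otimes> q) \<noteq> 1" using M.ord_eq_1[OF c] pq by simp
        ultimately show ?thesis using A prime_nat_iff by auto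
      next
        assume D: ?differ
        have "multiplicity r m \<noteq> multiplicity r n" if "prime r" "r dvd lcm m n" for r
        proof -
          have "r dvd m * n" using that(2) by (rule dvd_trans) (simp add: lcm_least)
          hence "r dvd m \<or> r dvd n" using that(1) by (simp add: prime_dvd_mult_iff)
          hence "r \<in> prime_factors m \<union> prime_factors n"
            using that assms by (auto simp: in_prime_factors_iff)
          thus ?thesis using D by force
        qed
        thus ?thesis using M.ord_mult_eq_lcm[OF p(1) q(1)] p q assms by simp
      qed
    qed
  qed
qed

end
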